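(* Let $\mathcal M\subset\mathbb R^N$ be a $d$-dimensional $C^2$ embedded manifold, let $\mathcal W\subset\mathcal M$ be open (in $\mathcal M$), and let $\mathcal U\subset\mathbb R^d$ be open. Assume that $(\mathcal W,\Phi)$, with $\Phi:\mathcal W\to\mathcal U$, is a $C^2$ coordinate chart on $\mathcal M$, and denote its inverse parametrization by $$\Gamma=\Phi^{-1}:\mathcal U\to\mathcal W\subset\mathcal M\subset\mathbb R^N,$$ i.e. $\Gamma$ is a $C^2$ embedding of $\mathcal U$ onto $\mathcal W$. Fix $\mathbf y\in\mathcal U$ and $K\in\mathbb N$. For each sample size $M$, let $\mathbf y_{S_M(1)},\ldots,\mathbf y_{S_M(K)}$ be the latent points selected by the $K$-nearest-neighbors construction for the query point $\mathbf y$, with corresponding points $\mathbf x_{S_M(j)}\in\mathcal W$ satisfying $$\mathbf y_{S_M(j)}=\Phi\bigl(\mathbf x_{S_M(j)}\bigr),\qquad j=1,\ldots,K.$$ Let the coefficients $b_{j,M}(\mathbf y)$ satisfy $$b_{j,M}(\mathbf y)\ge 0,\qquad \sum_{j=1}^{K}b_{j,M}(\mathbf y)=1,$$ and define $$\Gamma_M(\mathbf y)=\sum_{j=1}^{K}b_{j,M}(\mathbf y)\,\mathbf x_{S_M(j)},\qquad q_M(\mathbf y)=\Bigl\|\mathbf y-\sum_{j=1}^{K}b_{j,M}(\mathbf y)\,\mathbf y_{S_M(j)}\Bigr\|_2,\qquad h_M(\mathbf y)=\max_{1\le j\le K}\bigl\|\mathbf y_{S_M(j)}-\mathbf y\bigr\|_2.$$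 Assume that $h_M(\mathbf y)\to 0$ as $M\to\infty$. Then there exist $C_{\mathbf y}>0$ and $M_0\in\mathbb N$, independent of $M$, such that $$\bigl\|\Gamma_M(\mathbf y)-\Gamma(\mathbf y)\bigr\|_2\le C_{\mathbf y}\bigl(q_M(\mathbf y)+h_M(\mathbf y)^2\bigr),\qquad M\ge M_0.$$ Consequently, $\Gamma_M(\mathbf y)\to\Gamma(\mathbf y)$ as $M\to\infty$. If in addition $q_M(\mathbf y)=\mathcal O\bigl(h_M(\mathbf y)^2\bigr)$, then $$\bigl\|\Gamma_M(\mathbf y)-\Gamma(\mathbf y)\bigr\|_2=\mathcal O\bigl(h_M(\mathbf y)^2\bigr).$$
   Context: $\|\cdot\|_2$ denotes the Euclidean norm (on $\mathbb R^d$ or $\mathbb R^N$), and $\mathcal O(\cdot)$ is understood as $M\to\infty$ with $\mathbf y$ fixed. $K$-nearest-neighbors construction: for each sample size $M$ there is a finite set of $M$ training points (snapshots) in $\mathbb R^N$, each with a latent representation in $\mathbb R^d$. Given a query latent point $\mathbf y$, the points $\mathbf y_{S_M(1)},\ldots,\mathbf y_{S_M(K)}$ are the $K$ nearest neighbors of $\mathbf y$ (in Euclidean distance) among the latent representations of the training data, $S_M(j)$ being the index of the $j$-th selected training point, and $\mathbf x_{S_M(1)},\ldots,\mathbf x_{S_M(K)}$ are the corresponding training snapshots. The map $\Gamma_M$ is the convex $K$-NN pre-image (lifting) map, which approximates $\Gamma$. The weights $b_{j,M}(\mathbf y)$ may depend on $\mathbf y$ and $M$; the only conditions imposed on them are nonnegativity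 and summing to one. *)

theory Defs
  imports "HOL-Analysis.Analysis" "HOL-Library.Landau_Symbols"
begin

definition C2_on_open :: "('a::real_normed_vector) set \<Rightarrow> ('a \<Rightarrow> 'b::real_normed_vector) \<Rightarrow> bool" where
  "C2_on_open U f \<longleftrightarrow> open U \<and>
     (\<exists>f' :: 'a \<Rightarrow> 'a \<Rightarrow>\<^sub>L 'b. \<exists>f'' :: 'a \<Rightarrow> 'a \<Rightarrow>\<^sub>L ('a \<Rightarrow>\<^sub>L 'b).
        (\<forall>x\<in>U. (f has_derivative blinfun_apply (f' x)) (at x)) \<and>
        (\<forall>x\<in>U. (f' has_derivative blinfun_apply (f'' x)) (at x)) \<and>
        continuous_on U f'')"

text \<open>On a subset of Euclidean space that need not be open, \<open>C\<^sup>2\<close> means, as usual for embedded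
  manifolds, locally the restriction of a \<open>C\<^sup>2\<close> map of the ambient space.\<close>

definition C2_on :: "('a::real_normed_vector) set \<Rightarrow> ('a \<Rightarrow> 'b::real_normed_vector) \<Rightarrow> bool" where
  "C2_on S f \<longleftrightarrow> (\<forall>x\<in>S. \<exists>T g. x \<in> T \<and> C2_on_open T g \<and> (\<forall>z\<in>S \<inter> T. g z = f z))"

text \<open>A chart is a \<open>C\<^sup>2\<close> diffeomorphism from a relatively open set \<open>\<W>\<close> onto an open set \<open>\<U>\<close>.
  That its inverse is a \<open>C\<^sup>2\<close> embedding (an immersion and a homeomorphism onto \<open>\<W>\<close>) follows; see
  \<open>C2_chart_homeomorphism\<close> and \<open>C2_chart_immersion\<close> below.\<close>

definition C2_chart ::
    "(real^'n) set \<Rightarrow> (real^'n) set \<Rightarrow> (real^'d) set \<Rightarrow> (real^'n \<Rightarrow> real^'d) \<Rightarrow> bool" where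
  "C2_chart \<M> \<W> \<U> \<Phi> \<longleftrightarrow>
     openin (top_of_set \<M>) \<W> \<and> open \<U> \<and> bij_betw \<Phi> \<W> \<U> \<and>
     C2_on \<W> \<Phi> \<and> C2_on_open \<U> (inv_into \<W> \<Phi>)"

text \<open>The dimension is \<open>CARD('d)\<close>.\<close>

definition C2_embedded_manifold :: "'d::finite itself \<Rightarrow> (real^'n) set \<Rightarrow> bool" where
  "C2_embedded_manifold _ \<M> \<longleftrightarrow>
     (\<forall>p\<in>\<M>. \<exists>\<W> (\<U> :: (real^'d) set) \<Phi>. p \<in> \<W> \<and> C2_chart \<M> \<W> \<U> \<Phi>)"

lemma C2_on_open_imp_continuous_on: "C2_on_open U f \<Longrightarrow> continuous_on U f"
  unfolding C2_on_open_def
  by (auto intro!: continuous_at_imp_continuous_on intro: has_derivative_continuous)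

lemma C2_on_imp_continuous_on:
  assumes "C2_on S f"
  shows "continuous_on S f"
  unfolding continuous_on_eq_continuous_within
proof
  fix x assume x: "x \<in> S"
  then obtain T g where T: "x \<in> T" "C2_on_open T g" "\<forall>z\<in>S \<inter> T. g z = f z"
    using assms unfolding C2_on_def by blast
  have "open T" using T(2) by (simp add: C2_on_open_def)
  have "continuous (at x within S) g"
    using C2_on_open_imp_continuous_on[OF T(2)] \<open>open T\<close> T(1)
    by (simp add: continuous_on_eq_continuous_at continuous_at_imp_continuous_at_within)
  moreover have "\<forall>\<^sub>F z in at x within S. g z = f z"
    using T \<open>open T\<close> unfolding eventually_at_topological by blast
  moreover have "g x = f x" using T x by blast
  ultimately show "continuous (at x within S) f"
    unfolding continuous_within using Lim_transform_eventually[of g _ _ f] by simp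
qed

lemma C2_chart_homeomorphism:
  assumes "C2_chart \<M> \<W> \<U> \<Phi>"
  shows "homeomorphism \<W> \<U> \<Phi> (inv_into \<W> \<Phi>)"
proof
  have bij: "bij_betw \<Phi> \<W> \<U>"
    using assms by (simp add: C2_chart_def)
  show "continuous_on \<W> \<Phi>"
    using assms C2_on_imp_continuous_on by (auto simp: C2_chart_def)
  show "continuous_on \<U> (inv_into \<W> \<Phi>)"
    using assms C2_on_open_imp_continuous_on by (auto simp: C2_chart_def)
  show "\<Phi> ` \<W> \<subseteq> \<U>" "inv_into \<W> \<Phi> ` \<U> \<subseteq> \<W>"
    using bij by (auto simp: bij_betw_def inv_into_into)
  show "inv_into \<W> \<Phi> (\<Phi> x) = x" if "x \<in> \<W>" for x
    using bij that by (rule bij_betw_inv_into_left)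
  show "\<Phi> (inv_into \<W> \<Phi> z) = z" if "z \<in> \<U>" for z
    using bij that by (rule bij_betw_inv_into_right)
qed

lemma C2_chart_immersion:
  assumes "C2_chart \<M> \<W> \<U> \<Phi>" "y \<in> \<U>" "(inv_into \<W> \<Phi> has_derivative D) (at y)"
  shows "inj D"
proof -
  let ?G = "inv_into \<W> \<Phi>"
  have bij: "bij_betw \<Phi> \<W> \<U>" and U: "open \<U>"
    using assms(1) by (auto simp: C2_chart_def)
  have W: "?G z \<in> \<W>" "\<Phi> (?G z) = z" if "z \<in> \<U>" for z
    using bij that by (auto simp: bij_betw_def inv_into_into f_inv_into_f)
  obtain T g where T: "?G y \<in> T" "C2_on_open T g" "\<forall>z\<in>\<W> \<inter> T. g z = \<Phi> z"
    using assms(1) W(1)[OF assms(2)] unfolding C2_chart_def C2_on_def by blast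
  obtain E where E: "(g has_derivative E) (at (?G y))"
    using T unfolding C2_on_open_def by blast
  have "continuous_on \<U> ?G"
    using C2_chart_homeomorphism[OF assms(1)] by (simp add: homeomorphism_def)
  then have "open (?G -` T \<inter> \<U>)"
    using T(2) U continuous_on_open_vimage unfolding C2_on_open_def by blast
  then have "\<forall>z\<in>?G -` T \<inter> \<U>. (g \<circ> ?G) z = z" "open (?G -` T \<inter> \<U>)" "y \<in> ?G -` T \<inter> \<U>"
    using T W assms(2) by auto
  moreover have "((g \<circ> ?G) has_derivative (E \<circ> D)) (at y)"
    using diff_chain_at[OF assms(3) E] .
  ultimately have "((\<lambda>z. z) has_derivative (E \<circ> D)) (at y)"
    using has_derivative_transform_within_open[of "g \<circ> ?G" "E \<circ> D" y UNIV "?G -` T \<inter> \<U>" "\<lambda>z. z"]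
    by simp
  then have "E \<circ> D = (\<lambda>z. z)"
    by (rule has_derivative_unique[OF _ has_derivative_ident])
  then show "inj D"
    by (intro inj_on_inverseI[where g = E]) (simp add: fun_eq_iff)
qed

text \<open>In the following, a sample of size \<open>M\<close> is indexed by \<open>{1..M}\<close>, and \<open>s j\<close> is the index of the
  \<open>j\<close>-th selected sample point, \<open>1 \<le> j \<le> K\<close>. Ties in the distances may be broken arbitrarily and the
  neighbors may be listed in any order.\<close>

definition knn_selection ::
    "nat \<Rightarrow> nat \<Rightarrow> (nat \<Rightarrow> 'a::metric_space) \<Rightarrow> 'a \<Rightarrow> (nat \<Rightarrow> nat) \<Rightarrow> bool" where
  "knn_selection K M Y y s \<longleftrightarrow>
     inj_on s {1..K} \<and> s ` {1..K} \<subseteq> {1..M} \<and>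
     (\<forall>j\<in>{1..K}. \<forall>i\<in>{1..M} - s ` {1..K}. dist (Y (s j)) y \<le> dist (Y i) y)"

definition knn_combination ::
    "nat \<Rightarrow> (nat \<Rightarrow> real) \<Rightarrow> (nat \<Rightarrow> 'a::real_normed_vector) \<Rightarrow> (nat \<Rightarrow> nat) \<Rightarrow> 'a" where
  "knn_combination K b Z s = (\<Sum>j=1..K. b j *\<^sub>R Z (s j))"

definition knn_residual ::
    "nat \<Rightarrow> (nat \<Rightarrow> real) \<Rightarrow> (nat \<Rightarrow> 'a::real_normed_vector) \<Rightarrow> (nat \<Rightarrow> nat) \<Rightarrow> 'a \<Rightarrow> real" where
  "knn_residual K b Y s y = norm (y - knn_combination K b Y s)"

definition knn_radius ::
    "nat \<Rightarrow> (nat \<Rightarrow> 'a::real_normed_vector) \<Rightarrow> (nat \<Rightarrow> nat) \<Rightarrow> 'a \<Rightarrow> real" where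
  "knn_radius K Y s y = Max ((\<lambda>j. norm (Y (s j) - y)) ` {1..K})"

end

theory Submission
  imports Defs
begin

text \<open>
  Write \<open>\<Gamma>\<close> for the inverse of the chart and \<open>D\<close> for its derivative at the query point \<open>y\<close>. Near \<open>y\<close>
  the first-order Taylor remainder \<open>R(z)\<close> of the \<open>C\<^sup>2\<close> map \<open>\<Gamma>\<close> has norm at most \<open>B \<parallel>z - y\<parallel>\<^sup>2\<close>
  (\<open>C2_on_open_quadratic_remainder\<close>). Since the weights sum to one, averaging the expansions at the
  neighbors \<open>z\<^sub>j\<close> gives
  \<open>\<Sum>\<^sub>j b\<^sub>j \<Gamma> z\<^sub>j - \<Gamma> y = D (\<Sum>\<^sub>j b\<^sub>j z\<^sub>j - y) + \<Sum>\<^sub>j b\<^sub>j R(z\<^sub>j)\<close>.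
  By linearity the first-order terms see only the latent residual \<open>q\<close>, and by convexity the
  averaged remainder is at most \<open>B h\<^sup>2\<close> (\<open>convex_combination_image_error\<close>). The neighbors
  eventually lie in the neighborhood where the expansion is valid because \<open>h\<close> tends to zero, and
  there \<open>\<Gamma>\<close> sends them back to the training points because it inverts the chart.
  The error bound tends to zero with \<open>h\<close>, as \<open>q \<le> h\<close> for every convex combination
  (\<open>knn_residual_le_radius\<close>).
\<close>

text \<open>The derivative, being itself differentiable at \<open>x\<close>, moves by at most a multiple of \<open>\<rho>\<close> on the
  closed ball of radius \<open>\<rho>\<close> around \<open>x\<close>; the mean value inequality on that ball turns this into a
  remainder of order \<open>\<rho>\<^sup>2\<close>, for small \<open>\<rho>\<close>.\<close>

lemma C2_on_open_quadratic_remainder: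
  fixes f :: "'a::real_normed_vector \<Rightarrow> 'b::real_normed_vector"
  assumes "C2_on_open U f" and "x \<in> U"
  obtains D :: "'a \<Rightarrow>\<^sub>L 'b" and B r where "r > 0" and "B \<ge> 0"
    and "\<And>z. norm (z - x) < r \<Longrightarrow> norm (f z - f x - D (z - x)) \<le> B * (norm (z - x))\<^sup>2"
proof -
  obtain f' :: "'a \<Rightarrow> 'a \<Rightarrow>\<^sub>L 'b" and f'' :: "'a \<Rightarrow> 'a \<Rightarrow>\<^sub>L ('a \<Rightarrow>\<^sub>L 'b)"
    where U: "open U"
      and f': "\<And>z. z \<in> U \<Longrightarrow> (f has_derivative f' z) (at z)"
      and f'': "\<And>z. z \<in> U \<Longrightarrow> (f' has_derivative f'' z) (at z)"
    using assms(1) unfolding C2_on_open_def by blast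
  obtain d where d: "d > 0"
    and lin: "\<And>z. norm (z - x) < d \<Longrightarrow> norm (f' z - f' x - f'' x (z - x)) \<le> 1 * norm (z - x)"
    using f''[OF \<open>x \<in> U\<close>] unfolding has_derivative_at_alt by (meson zero_less_one)
  obtain e where e: "e > 0" and ball_U: "ball x e \<subseteq> U"
    using U \<open>x \<in> U\<close> openE by blast
  define B where "B = norm (f'' x) + 1"
  have B: "B \<ge> 0" by (simp add: B_def)
  have lipschitz: "norm (f' z - f' x) \<le> B * norm (z - x)" if "norm (z - x) < d" for z
  proof -
    have "norm (f' z - f' x) \<le> norm (f'' x (z - x)) + norm (f' z - f' x - f'' x (z - x))"
      by (metis add.commute diff_add_cancel norm_triangle_ineq)
    also have "\<dots> \<le> norm (f'' x) * norm (z - x) + 1 * norm (z - x)"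
      by (intro add_mono norm_blinfun lin that)
    finally show ?thesis by (simp add: B_def algebra_simps)
  qed
  have "norm (f z - f x - f' x (z - x)) \<le> B * (norm (z - x))\<^sup>2" if z: "norm (z - x) < min d e" for z
  proof -
    let ?C = "cball x (norm (z - x))"
    have near: "norm (w - x) \<le> norm (z - x)" if "w \<in> ?C" for w
      using that by (simp add: dist_norm norm_minus_commute)
    have "norm (f z - f x - f' x (z - x)) \<le> norm (z - x) * (B * norm (z - x))"
    proof (rule differentiable_bound_linearization[where S = ?C and f' = "\<lambda>w. blinfun_apply (f' w)"])
      show "x + t *\<^sub>R (z - x) \<in> ?C" if "t \<in> {0..1}" for t
        using that by (simp add: dist_norm mult_left_le_one_le)
      show "(f has_derivative f' w) (at w within ?C)" if "w \<in> ?C" for w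
      proof -
        have "w \<in> ball x e" using near[OF that] z by (simp add: dist_norm norm_minus_commute)
        then show ?thesis using ball_U f' has_derivative_at_withinI by blast
      qed
      show "onorm (blinfun_apply (f' w) - blinfun_apply (f' x)) \<le> B * norm (z - x)" if "w \<in> ?C" for w
      proof -
        have "norm (f' w - f' x) \<le> B * norm (w - x)"
          using near[OF that] z by (intro lipschitz) simp
        also have "\<dots> \<le> B * norm (z - x)"
          using near[OF that] B by (rule mult_left_mono)
        finally show ?thesis
          by (simp add: norm_blinfun.rep_eq minus_blinfun.rep_eq fun_diff_def)
      qed
    qed simp
    then show ?thesis by (simp add: power2_eq_square mult.left_commute)
  qed
  then show thesis
    using d e B that[of "min d e" B "f' x"] by simp
qed

text \<open>The constant term and the linear term of the expansion pass through a convex combination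
  exactly, so only the remainders are estimated pointwise.\<close>

lemma convex_combination_image_error:
  fixes f :: "'a::real_normed_vector \<Rightarrow> 'b::real_normed_vector" and D :: "'a \<Rightarrow>\<^sub>L 'b"
  assumes weights: "\<And>j. j \<in> J \<Longrightarrow> b j \<ge> 0" "sum b J = 1"
    and remainder: "\<And>j. j \<in> J \<Longrightarrow> norm (f (z j) - f x - D (z j - x)) \<le> \<epsilon>"
  shows "norm ((\<Sum>j\<in>J. b j *\<^sub>R f (z j)) - f x) \<le> norm D * norm (x - (\<Sum>j\<in>J. b j *\<^sub>R z j)) + \<epsilon>"
proof -
  let ?R = "\<lambda>j. f (z j) - f x - D (z j - x)"
  have average: "(\<Sum>j\<in>J. b j *\<^sub>R v) = v" "(\<Sum>j\<in>J. b j *\<^sub>R w) = w" for v :: 'a and w :: 'b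
    using weights(2) by (simp_all flip: scaleR_sum_left)
  have linear: "D ((\<Sum>j\<in>J. b j *\<^sub>R z j) - x) = (\<Sum>j\<in>J. b j *\<^sub>R D (z j - x))"
    by (simp add: blinfun.bilinear_simps blinfun.sum_right scaleR_diff_right sum_subtractf average)
  have "(\<Sum>j\<in>J. b j *\<^sub>R f (z j)) - f x = D ((\<Sum>j\<in>J. b j *\<^sub>R z j) - x) + (\<Sum>j\<in>J. b j *\<^sub>R ?R j)"
    unfolding linear by (simp add: scaleR_diff_right sum_subtractf average)
  moreover have "norm (D ((\<Sum>j\<in>J. b j *\<^sub>R z j) - x)) \<le> norm D * norm (x - (\<Sum>j\<in>J. b j *\<^sub>R z j))"
    by (metis norm_blinfun norm_minus_commute)
  moreover have "norm (\<Sum>j\<in>J. b j *\<^sub>R ?R j) \<le> \<epsilon>"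
  proof -
    have "norm (\<Sum>j\<in>J. b j *\<^sub>R ?R j) \<le> (\<Sum>j\<in>J. b j * \<epsilon>)"
      using weights(1) remainder by (intro sum_norm_le) (simp add: mult_left_mono)
    then show ?thesis using weights(2) by (simp flip: sum_distrib_right)
  qed
  ultimately show ?thesis by (smt (verit) norm_triangle_ineq)
qed

lemma norm_le_knn_radius:
  "j \<in> {1..K} \<Longrightarrow> norm (Y (s j) - y) \<le> knn_radius K Y s y"
  unfolding knn_radius_def by (intro Max_ge) auto

text \<open>A closed ball around \<open>y\<close> is convex, so it contains every convex combination of the
  neighbors that it contains.\<close>

lemma knn_residual_le_radius:
  assumes "\<And>j. j \<in> {1..K} \<Longrightarrow> b j \<ge> 0" and "(\<Sum>j=1..K. b j) = 1"
  shows "knn_residual K b Y s y \<le> knn_radius K Y s y"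
proof -
  have "knn_combination K b Y s \<in> cball y (knn_radius K Y s y)"
    unfolding knn_combination_def
    using assms norm_le_knn_radius[of _ K Y s y]
    by (intro convex_sum) (auto simp: dist_norm norm_minus_commute)
  then show ?thesis by (simp add: knn_residual_def dist_norm)
qed

theorem proposition2p1:
  fixes \<M> \<W> :: "(real^'n) set"
    and \<U> :: "(real^'d) set"
    and \<Phi> :: "real^'n \<Rightarrow> real^'d"
    and \<Gamma> :: "real^'d \<Rightarrow> real^'n"
    and y :: "real^'d"
    and K :: nat
    and X :: "nat \<Rightarrow> nat \<Rightarrow> real^'n"
    and Y :: "nat \<Rightarrow> nat \<Rightarrow> real^'d"
    and S :: "nat \<Rightarrow> nat \<Rightarrow> nat"
    and b :: "nat \<Rightarrow> nat \<Rightarrow> real"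
    and \<Gamma>\<^sub>M :: "nat \<Rightarrow> real^'n"
    and q h :: "nat \<Rightarrow> real"
  assumes manifold: "C2_embedded_manifold TYPE('d) \<M>"
    and chart: "C2_chart \<M> \<W> \<U> \<Phi>"
    and Gamma: "\<Gamma> = inv_into \<W> \<Phi>"
    and y: "y \<in> \<U>"
    and K: "1 \<le> K"
    and knn: "\<And>M. M \<ge> K \<Longrightarrow> knn_selection K M (Y M) y (S M)"
    and selected_in_W: "\<And>M j. M \<ge> K \<Longrightarrow> j \<in> {1..K} \<Longrightarrow> X M (S M j) \<in> \<W>"
    and latent: "\<And>M j. M \<ge> K \<Longrightarrow> j \<in> {1..K} \<Longrightarrow> Y M (S M j) = \<Phi> (X M (S M j))"
    and weights_nonneg: "\<And>M j. M \<ge> K \<Longrightarrow> j \<in> {1..K} \<Longrightarrow> b M j \<ge> 0"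
    and weights_sum: "\<And>M. M \<ge> K \<Longrightarrow> (\<Sum>j=1..K. b M j) = 1"
    and Gamma_M: "\<And>M. \<Gamma>\<^sub>M M = knn_combination K (b M) (X M) (S M)"
    and q: "\<And>M. q M = knn_residual K (b M) (Y M) (S M) y"
    and h: "\<And>M. h M = knn_radius K (Y M) (S M) y"
    and h_tendsto: "h \<longlonglongrightarrow> 0"
  shows "(\<exists>C>0. \<exists>M\<^sub>0. \<forall>M\<ge>M\<^sub>0. norm (\<Gamma>\<^sub>M M - \<Gamma> y) \<le> C * (q M + (h M)\<^sup>2)) \<and>
         \<Gamma>\<^sub>M \<longlonglongrightarrow> \<Gamma> y \<and>
         (q \<in> O(\<lambda>M. (h M)\<^sup>2) \<longrightarrow>
            (\<lambda>M. norm (\<Gamma>\<^sub>M M - \<Gamma> y)) \<in> O(\<lambda>M. (h M)\<^sup>2))"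
proof -
  have inverse: "X M (S M j) = \<Gamma> (Y M (S M j))" if "M \<ge> K" "j \<in> {1..K}" for M j
    using C2_chart_homeomorphism[OF chart] selected_in_W[OF that] latent[OF that]
    by (simp add: Gamma homeomorphism_def)
  have "C2_on_open \<U> \<Gamma>"
    using chart by (simp add: C2_chart_def Gamma)
  then obtain D :: "(real^'d) \<Rightarrow>\<^sub>L (real^'n)" and B r where r: "r > 0" and B: "B \<ge> 0"
    and remainder: "\<And>z. norm (z - y) < r \<Longrightarrow> norm (\<Gamma> z - \<Gamma> y - D (z - y)) \<le> B * (norm (z - y))\<^sup>2"
    using y by (rule C2_on_open_quadratic_remainder) blast
  have q_nonneg: "q M \<ge> 0" for M
    by (simp add: q knn_residual_def)
  have q_le_h: "q M \<le> h M" if "M \<ge> K" for M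
    unfolding q h using weights_nonneg[OF that] weights_sum[OF that] by (rule knn_residual_le_radius)
  \<comment> \<open>The summand \<open>1\<close> only makes the constant positive.\<close>
  define C where "C = norm D + B + 1"
  have C: "C > 0" using B by (simp add: C_def add_nonneg_pos)
  have bound: "norm (\<Gamma>\<^sub>M M - \<Gamma> y) \<le> C * (q M + (h M)\<^sup>2)" if M: "M \<ge> K" "h M < r" for M
  proof -
    have "norm (\<Gamma> (Y M (S M j)) - \<Gamma> y - D (Y M (S M j) - y)) \<le> B * (h M)\<^sup>2" if j: "j \<in> {1..K}" for j
    proof -
      have near: "norm (Y M (S M j) - y) \<le> h M"
        unfolding h using j by (rule norm_le_knn_radius)
      have "norm (\<Gamma> (Y M (S M j)) - \<Gamma> y - D (Y M (S M j) - y)) \<le> B * (norm (Y M (S M j) - y))\<^sup>2"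
        using near M(2) by (intro remainder) simp
      also have "\<dots> \<le> B * (h M)\<^sup>2"
        using near B by (intro mult_left_mono power_mono) auto
      finally show ?thesis .
    qed
    with weights_nonneg[OF M(1)] weights_sum[OF M(1)]
    have "norm ((\<Sum>j=1..K. b M j *\<^sub>R \<Gamma> (Y M (S M j))) - \<Gamma> y)
        \<le> norm D * norm (y - (\<Sum>j=1..K. b M j *\<^sub>R Y M (S M j))) + B * (h M)\<^sup>2"
      by (rule convex_combination_image_error)
    moreover have "\<Gamma>\<^sub>M M = (\<Sum>j=1..K. b M j *\<^sub>R \<Gamma> (Y M (S M j)))"
      unfolding Gamma_M knn_combination_def using inverse[OF M(1)] by (intro sum.cong) auto
    ultimately have "norm (\<Gamma>\<^sub>M M - \<Gamma> y) \<le> norm D * q M + B * (h M)\<^sup>2"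
      by (simp add: q knn_residual_def knn_combination_def)
    also have "\<dots> \<le> C * q M + C * (h M)\<^sup>2"
      using B q_nonneg[of M] by (intro add_mono mult_right_mono) (auto simp: C_def)
    finally show ?thesis by (simp add: distrib_left)
  qed
  have ev_bound: "\<forall>\<^sub>F M in sequentially. norm (\<Gamma>\<^sub>M M - \<Gamma> y) \<le> C * (q M + (h M)\<^sup>2)"
    using eventually_ge_at_top[of K] order_tendstoD(2)[OF h_tendsto r]
    by eventually_elim (rule bound)
  have "q \<longlonglongrightarrow> 0"
  proof (rule tendsto_sandwich[OF _ _ tendsto_const h_tendsto])
    show "\<forall>\<^sub>F M in sequentially. 0 \<le> q M" by (simp add: q_nonneg)
    show "\<forall>\<^sub>F M in sequentially. q M \<le> h M"
      using eventually_ge_at_top[of K] by (rule eventually_mono) (rule q_le_h)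
  qed
  then have "(\<lambda>M. C * (q M + (h M)\<^sup>2)) \<longlonglongrightarrow> C * (0 + 0\<^sup>2)"
    by (intro tendsto_intros h_tendsto)
  then have "(\<lambda>M. C * (q M + (h M)\<^sup>2)) \<longlonglongrightarrow> 0"
    by simp
  with ev_bound have "(\<lambda>M. \<Gamma>\<^sub>M M - \<Gamma> y) \<longlonglongrightarrow> 0"
    by (rule Lim_null_comparison)
  then have limit: "\<Gamma>\<^sub>M \<longlonglongrightarrow> \<Gamma> y"
    by (rule LIM_zero_cancel)
  have rate: "(\<lambda>M. norm (\<Gamma>\<^sub>M M - \<Gamma> y)) \<in> O(\<lambda>M. (h M)\<^sup>2)" if q_bigo: "q \<in> O(\<lambda>M. (h M)\<^sup>2)"
  proof -
    have "(\<lambda>M. norm (\<Gamma>\<^sub>M M - \<Gamma> y)) \<in> O(\<lambda>M. q M + (h M)\<^sup>2)"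
    proof (rule landau_o.bigI[OF C])
      show "\<forall>\<^sub>F M in sequentially. norm (norm (\<Gamma>\<^sub>M M - \<Gamma> y)) \<le> C * norm (q M + (h M)\<^sup>2)"
        using ev_bound by (rule eventually_mono) (simp add: q_nonneg)
    qed
    moreover have "(\<lambda>M. q M + (h M)\<^sup>2) \<in> O(\<lambda>M. (h M)\<^sup>2)"
      using q_bigo landau_o.big_refl by (rule sum_in_bigo(1))
    ultimately show ?thesis by (rule landau_o.big_trans)
  qed
  moreover have "\<exists>M\<^sub>0. \<forall>M\<ge>M\<^sub>0. norm (\<Gamma>\<^sub>M M - \<Gamma> y) \<le> C * (q M + (h M)\<^sup>2)"
    using ev_bound unfolding eventually_sequentially .
  ultimately show ?thesis
    using C limit by (intro conjI impI exI[of _ C])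
qed

end
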